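(* Let $K\subset\mathbb{R}^2$ be a convex body (compact convex set) and write $r=r(K)$, $w=w(K)$, $D=D(K)$, $R=R(K)$. Then \[ w \ \ge\ 2D\sqrt{1-\left(\frac{D}{2R}\right)^2}\;\cos\!\left[\arccos\!\left(\frac{D}{2(D-r)}\right)+\arccos\!\left(\frac{D}{2R}\right)-\arcsin\!\left(\frac{r}{D-r}\right)\right]. \]
   Context: For a convex body $K\subset\mathbb{R}^n$: the diameter $D(K)$ is the largest distance between two points of $K$; the width $w(K)$ is the smallest distance between two distinct parallel supporting hyperplanes (lines in the plane) of $K$; the inradius $r(K)$ is the radius of a largest Euclidean ball contained in $K$; the circumradius $R(K)$ is the radius of the smallest Euclidean ball containing $K$. *)

theory Defs
  imports "HOL-Analysis.Analysis"
begin

definition width :: "(real^2) set \<Rightarrow> real" where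
  "width K = (INF u\<in>sphere 0 1. (SUP x\<in>K. u \<bullet> x) - (INF x\<in>K. u \<bullet> x))"

definition inradius :: "(real^2) set \<Rightarrow> real" where
  "inradius K = Sup {r. r \<ge> 0 \<and> (\<exists>c. cball c r \<subseteq> K)}"

definition circumradius :: "(real^2) set \<Rightarrow> real" where
  "circumradius K = Inf {r. \<exists>c. K \<subseteq> cball c r}"

end

theory Submission
  imports Defs
begin

text \<open>
  The circumcentre is a convex combination of three points of \<open>K\<close> on the circumcircle. With
  \<open>D = 2 R cos \<alpha>\<close> their triangle has all its sides at most \<open>D\<close>, hence all its angles between
  \<open>2 \<alpha>\<close> and \<open>\<pi>/2 - \<alpha>\<close>. An inball with centre \<open>c\<close> forces \<open>K\<close> into the disk of radius
  \<open>\<rho> = D - r\<close> about \<open>c\<close>.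

  Fix a direction \<open>u\<close>, let \<open>p\<close>, \<open>s\<close>, \<open>q\<close> be the three points in increasing order of height, and let \<open>\<psi>\<close> be
  the inclination of \<open>p s\<close>. If both \<open>p s\<close> and \<open>s q\<close> have inclination at least \<open>\<alpha>\<close>, the triangle alone
  has breadth at least \<open>2 D sin \<alpha>\<close>. Otherwise, by symmetry, \<open>\<psi> < \<alpha>\<close>, and the triangle has breadth at least
  \<open>2 D sin \<alpha> cos (\<alpha> - \<psi>)\<close>. This suffices if \<open>\<psi> \<ge> \<gamma> - \<beta>\<close>, where \<open>cos \<beta> = D / (2 \<rho>)\<close> and
  \<open>sin \<gamma> = r / \<rho>\<close>. If \<open>\<psi> < \<gamma> - \<beta>\<close>, then \<open>c\<close> lies in the lens of the disks of radius \<open>\<rho>\<close> about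
  \<open>p\<close> and \<open>s\<close>, so that the inball reaches below \<open>p\<close>. The resulting bound is worst when \<open>p s\<close> has length \<open>D\<close>,
  and it then decreases in \<open>\<psi>\<close> up to its value at \<open>\<gamma> - \<beta>\<close>, which is the claim.
\<close>

section \<open>A triangle in its circumcircle\<close>

text \<open>A quarter turn of \<open>e\<close> gives the second axis; the identity is Parseval's for
  this orthonormal basis. The sign of the axis is free and is spent on the side of
  \<open>t\<close>.\<close>

lemma orthonormal_frame:
  fixes e t :: "real^2"
  assumes "norm e = 1"
  obtains n where "n \<bullet> t \<ge> 0" "e \<bullet> n = 0"
    "\<And>x y. x \<bullet> y = (x \<bullet> e) * (y \<bullet> e) + (x \<bullet> n) * (y \<bullet> n)"
proof -
  define m :: "real^2" where "m = vector [- e $ 2, e $ 1]"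
  have m: "m $ 1 = - e $ 2" "m $ 2 = e $ 1" by (simp_all add: m_def)
  have e: "e $ 1 * e $ 1 + e $ 2 * e $ 2 = 1"
    using assms by (simp add: norm_eq_1 inner_vec_def sum_2)
  have perp: "e \<bullet> m = 0" by (simp add: inner_vec_def sum_2 m)
  have id: "x \<bullet> y = (x \<bullet> e) * (y \<bullet> e) + (x \<bullet> m) * (y \<bullet> m)" for x y
  proof -
    have "(x \<bullet> e) * (y \<bullet> e) + (x \<bullet> m) * (y \<bullet> m)
        = (x $ 1 * y $ 1 + x $ 2 * y $ 2) * (e $ 1 * e $ 1 + e $ 2 * e $ 2)"
      by (simp add: inner_vec_def sum_2 m algebra_simps)
    then show ?thesis by (simp add: e inner_vec_def sum_2)
  qed
  show ?thesis
  proof (cases "m \<bullet> t \<ge> 0")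
    case True
    then show ?thesis using that perp id by blast
  next
    case False
    show ?thesis
    proof (rule that)
      show "- m \<bullet> t \<ge> 0" using False by simp
      show "e \<bullet> - m = 0" using perp by simp
      show "x \<bullet> y = (x \<bullet> e) * (y \<bullet> e) + (x \<bullet> - m) * (y \<bullet> - m)" for x y
        using id[of x y] by simp
    qed
  qed
qed

text \<open>The angle is measured from the second axis, so that \<open>arcsin\<close> alone recovers
  it on the half circle \<open>y \<ge> 0\<close>, where the cosine is nonnegative.\<close>

lemma arcsin_polar:
  fixes x y :: real
  assumes "x\<^sup>2 + y\<^sup>2 = R\<^sup>2" "R > 0" "y \<ge> 0"
  shows "x = R * sin (arcsin (x / R))" "y = R * cos (arcsin (x / R))"
proof -
  have "x\<^sup>2 \<le> R\<^sup>2" using assms(1) zero_le_power2[of y] by linarith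
  then have "\<bar>x\<bar> \<le> R" using assms(2) by (simp add: abs_le_square_iff[symmetric])
  then have b: "-1 \<le> x / R" "x / R \<le> 1" using assms(2) by (auto simp: field_simps)
  then show "x = R * sin (arcsin (x / R))" using assms(2) by simp
  have "1 - (x / R)\<^sup>2 = (y / R)\<^sup>2"
    using assms(1,2) by (simp add: field_simps)
  then have "cos (arcsin (x / R)) = y / R"
    using b assms(2,3) by (simp add: cos_arcsin)
  then show "y = R * cos (arcsin (x / R))" using assms(2) by simp
qed

text \<open>With \<open>e\<close> along \<open>p s\<close> and \<open>n\<close> pointing from that
  side towards the centre, \<open>Q\<close> is the angle of the triangle at \<open>q\<close>, while
  the angles at \<open>p\<close> and \<open>s\<close> are \<open>pi / 2 - (Q + \<zeta>) / 2\<close>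
  and \<open>pi / 2 - (Q - \<zeta>) / 2\<close>. The ranges express that no angle exceeds
  \<open>pi / 2 - \<alpha>\<close>, since no side exceeds
  \<open>2 * R * cos \<alpha>\<close>.\<close>

lemma triangle_frame:
  fixes p q s u :: "real^2"
  assumes R: "R > 0" and al: "0 < \<alpha>" "\<alpha> < pi / 2"
    and on_circle: "norm p = R" "norm q = R" "norm s = R"
    and sides: "dist p q \<le> 2 * R * cos \<alpha>" "dist q s \<le> 2 * R * cos \<alpha>" "dist p s \<le> 2 * R * cos \<alpha>"
    and hull: "a *\<^sub>R p + b *\<^sub>R q + c *\<^sub>R s = 0" "0 \<le> a" "0 \<le> b" "0 \<le> c" "a + b + c = 1"
    and u: "norm u = 1" "u \<bullet> p \<le> u \<bullet> s" "u \<bullet> s \<le> u \<bullet> q"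
  obtains e n Q \<zeta> \<psi> where
    "\<And>x y. x \<bullet> y = (x \<bullet> e) * (y \<bullet> e) + (x \<bullet> n) * (y \<bullet> n)"
    "p \<bullet> e = - R * sin Q" "p \<bullet> n = - R * cos Q"
    "s \<bullet> e = R * sin Q" "s \<bullet> n = - R * cos Q"
    "q \<bullet> e = R * sin \<zeta>" "q \<bullet> n = R * cos \<zeta>"
    "u \<bullet> e = sin \<psi>" "u \<bullet> n = cos \<psi>"
    "2 * \<alpha> \<le> Q" "Q \<le> pi / 2 - \<alpha>" "\<bar>\<zeta>\<bar> \<le> Q - 2 * \<alpha>" "0 \<le> \<psi>" "\<psi> \<le> pi / 2"
proof -
  have cos2: "1 - 2 * (cos \<alpha>)\<^sup>2 = - cos (2 * \<alpha>)" by (simp add: cos_double_cos)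
  have sqn: "x \<bullet> x = R\<^sup>2" if "norm x = R" for x :: "real^2"
    using that by (simp add: dot_square_norm)
  \<comment> \<open>In terms of angles: a chord of length at most
    \<open>2 * R * cos \<alpha>\<close> has central angle at most
    \<open>pi - 2 * \<alpha>\<close>.\<close>
  have in_lower: "- R\<^sup>2 * cos (2 * \<alpha>) \<le> x \<bullet> y"
    if "norm x = R" "norm y = R" "dist x y \<le> 2 * R * cos \<alpha>" for x y :: "real^2"
  proof -
    have "(dist x y)\<^sup>2 \<le> (2 * R * cos \<alpha>)\<^sup>2" using that(3) by (intro power_mono) auto
    moreover have "(dist x y)\<^sup>2 = 2 * R\<^sup>2 - 2 * (x \<bullet> y)"
      using sqn[OF that(1)] sqn[OF that(2)]
      by (simp add: dist_norm power2_norm_eq_inner inner_diff_left inner_diff_right inner_commute)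
    ultimately have "R\<^sup>2 * (1 - 2 * (cos \<alpha>)\<^sup>2) \<le> x \<bullet> y"
      by (simp add: power_mult_distrib algebra_simps)
    then show ?thesis unfolding cos2 by simp
  qed
  have in_upper: "- (x \<bullet> y) \<le> R\<^sup>2" if "norm x = R" "norm y = R" for x y :: "real^2"
    using norm_cauchy_schwarz[of "-x" y] that by (simp add: power2_eq_square)
  have cos2lt: "cos (2 * \<alpha>) < 1" using cos_monotone_0_pi[of 0 "2 * \<alpha>"] al by simp
  have neg: "- R\<^sup>2 < - R\<^sup>2 * cos (2 * \<alpha>)" using R cos2lt by simp
  \<comment> \<open>The centre lies on no side, since that side would be a diameter. Hence
    \<open>q\<close> has positive weight and \<open>p\<close>, \<open>s\<close> are
    distinct.\<close>
  have no_antipodal: False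
    if "norm x = R" "norm y = R" "dist x y \<le> 2 * R * cos \<alpha>" "k *\<^sub>R x + l *\<^sub>R y = 0" "k + l = 1"
    for x y :: "real^2" and k l
  proof -
    have "(k *\<^sub>R x + l *\<^sub>R y) \<bullet> (x + y) = (k + l) * (R\<^sup>2 + x \<bullet> y)"
      using sqn[OF that(1)] sqn[OF that(2)]
      by (simp add: inner_add_left inner_add_right inner_commute algebra_simps)
    then have "R\<^sup>2 + x \<bullet> y = 0" using that(4,5) by simp
    then show False using in_lower[OF that(1-3)] neg by linarith
  qed
  have b0: "b > 0"
  proof (rule ccontr)
    assume "\<not> b > 0"
    then have "b = 0" using hull(3) by simp
    then show False using no_antipodal[OF on_circle(1,3) sides(3), of a c] hull by simp
  qed
  have ps: "p \<noteq> s"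
  proof
    assume "p = s"
    then have "(a + c) *\<^sub>R p + b *\<^sub>R q = 0" using hull(1) by (simp add: algebra_simps)
    then show False using no_antipodal[OF on_circle(1,2) sides(1), of "a + c" b] hull(5) by simp
  qed
  \<comment> \<open>Pairing the hull relation with \<open>q\<close> bounds its weight; the component
    along \<open>n\<close> then puts \<open>q\<close> at least as far above the centre as
    \<open>p s\<close> is below it, whence \<open>\<bar>\<zeta>\<bar> \<le> Q\<close>.\<close>
  have b_le: "b \<le> a + c"
  proof -
    have "(a *\<^sub>R p + b *\<^sub>R q + c *\<^sub>R s) \<bullet> q = 0" using hull(1) by simp
    then have "b * R\<^sup>2 = a * - (p \<bullet> q) + c * - (s \<bullet> q)"
      using sqn[OF on_circle(2)] by (simp add: inner_add_left)
    also have "\<dots> \<le> a * R\<^sup>2 + c * R\<^sup>2"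
      using hull in_upper on_circle by (intro add_mono mult_left_mono) auto
    finally have "b * R\<^sup>2 \<le> (a + c) * R\<^sup>2" by (simp add: algebra_simps)
    then show ?thesis using R by simp
  qed
  define d where "d = norm (s - p)"
  define e where "e = (s - p) /\<^sub>R d"
  have d: "d > 0" using ps by (simp add: d_def)
  have e: "norm e = 1" "s - p = d *\<^sub>R e" using d by (auto simp: e_def d_def)
  obtain n where n: "n \<bullet> - p \<ge> 0" "e \<bullet> n = 0"
    and fr: "\<And>x y. x \<bullet> y = (x \<bullet> e) * (y \<bullet> e) + (x \<bullet> n) * (y \<bullet> n)"
    using orthonormal_frame[OF e(1), of "- p"] by metis
  have ee: "e \<bullet> e = 1" using e(1) by (simp add: norm_eq_1)
  have "(s - p) \<bullet> (s + p) = 0"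
    using sqn[OF on_circle(1)] sqn[OF on_circle(3)]
    by (simp add: inner_diff_left inner_add_right inner_commute[of s p])
  then have "s \<bullet> e + p \<bullet> e = 0" using d unfolding e(2) by (simp add: inner_add_right inner_commute[of e] flip: distrib_left)
  moreover have "s \<bullet> e - p \<bullet> e = d"
    using ee unfolding inner_diff_left[symmetric] e(2) by simp
  ultimately have se: "s \<bullet> e = d / 2" and pe: "p \<bullet> e = - d / 2" by auto
  have sn: "s \<bullet> n = p \<bullet> n"
    using n(2) unfolding eq_iff_diff_eq_0[of "s \<bullet> n"] inner_diff_left[symmetric] e(2) by simp
  define \<kappa> where "\<kappa> = - (p \<bullet> n)"
  have kap: "\<kappa> \<ge> 0" using n(1) by (simp add: \<kappa>_def inner_commute)
  define Q where "Q = arcsin (d / 2 / R)"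
  have "(d / 2)\<^sup>2 + \<kappa>\<^sup>2 = R\<^sup>2"
    using sqn[OF on_circle(1)] fr[of p p] pe by (simp add: \<kappa>_def power2_eq_square)
  note pol = arcsin_polar[OF this R kap, folded Q_def]
  have pn: "p \<bullet> n = - (R * cos Q)" using pol(2) by (simp add: \<kappa>_def)
  have d2: "d \<le> 2 * R * cos \<alpha>" using sides(3) by (simp add: d_def dist_norm norm_minus_commute)
  have "d / 2 / R \<le> cos \<alpha>" using d2 R by (simp add: field_simps)
  then have "Q \<le> arcsin (cos \<alpha>)" using d R by (auto simp: Q_def intro!: arcsin_le_arcsin intro: order_trans[of _ 0])
  also have "\<dots> = pi / 2 - \<alpha>" using al by (simp add: cos_sin_eq arcsin_sin)
  finally have Qle: "Q \<le> pi / 2 - \<alpha>" .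
  have "d / 2 / R \<le> 1" using \<open>d / 2 / R \<le> cos \<alpha>\<close> cos_le_one[of \<alpha>] by linarith
  then have Q0: "0 \<le> Q" using d R arcsin_le_arcsin[of 0 "d / 2 / R"] by (simp add: Q_def)
  have cosQ: "cos Q > 0" using Qle Q0 al by (intro cos_gt_zero_pi) auto
  then have kap0: "\<kappa> > 0" using pol(2) R by simp
  have "(a *\<^sub>R p + b *\<^sub>R q + c *\<^sub>R s) \<bullet> n = 0" using hull(1) by simp
  then have "b * (q \<bullet> n) = (a + c) * \<kappa>" by (simp add: inner_add_left sn \<kappa>_def algebra_simps)
  also have "\<dots> \<ge> b * \<kappa>" using b_le kap by (simp add: mult_right_mono)
  finally have qn: "\<kappa> \<le> q \<bullet> n" using b0 by simp
  define \<zeta> where "\<zeta> = arcsin ((q \<bullet> e) / R)"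
  have qq: "(q \<bullet> e)\<^sup>2 + (q \<bullet> n)\<^sup>2 = R\<^sup>2"
    using sqn[OF on_circle(2)] fr[of q q] by (simp add: power2_eq_square)
  have "0 \<le> q \<bullet> n" using qn kap by simp
  note polq = arcsin_polar[OF qq R this, folded \<zeta>_def]
  have zb: "-(pi/2) \<le> \<zeta>" "\<zeta> \<le> pi / 2"
  proof -
    have "(q \<bullet> e)\<^sup>2 \<le> R\<^sup>2" using qq zero_le_power2[of "q \<bullet> n"] by linarith
    then have "\<bar>q \<bullet> e\<bar> \<le> R" using R by (simp add: abs_le_square_iff[symmetric])
    then have "-1 \<le> q \<bullet> e / R" "q \<bullet> e / R \<le> 1" using R by (auto simp: field_simps)
    then show "-(pi/2) \<le> \<zeta>" "\<zeta> \<le> pi / 2" unfolding \<zeta>_def by (rule arcsin_lbound arcsin_ubound; assumption)+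
  qed
  have "cos Q \<le> cos \<bar>\<zeta>\<bar>" using qn pol(2) polq(2) R by simp
  then have zQ: "\<bar>\<zeta>\<bar> \<le> Q" using zb Q0 Qle al by (subst (asm) cos_mono_le_eq) auto
  have angle: "2 * \<alpha> \<le> t" if "0 \<le> t" "t \<le> pi" "- R\<^sup>2 * cos (2 * \<alpha>) \<le> - R\<^sup>2 * cos t" for t
  proof -
    have "cos t \<le> cos (2 * \<alpha>)" using that(3) R by simp
    then show ?thesis using that al by (subst (asm) cos_mono_le_eq) auto
  qed
  have "q \<bullet> s = - R\<^sup>2 * cos (Q + \<zeta>)"
    using pol(1) polq pn unfolding fr[of q s] se sn cos_add
    by (simp add: power2_eq_square algebra_simps)
  then have 1: "2 * \<alpha> \<le> Q + \<zeta>"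
    using in_lower[OF on_circle(2,3) sides(2)] zQ Qle al by (intro angle) auto
  have "p \<bullet> q = - R\<^sup>2 * cos (Q - \<zeta>)"
    using pol(1) polq pn unfolding fr[of p q] pe cos_diff
    by (simp add: power2_eq_square algebra_simps)
  then have 2: "2 * \<alpha> \<le> Q - \<zeta>"
    using in_lower[OF on_circle(1,2) sides(1)] zQ Qle al by (intro angle) auto
  have zz: "\<bar>\<zeta>\<bar> \<le> Q - 2 * \<alpha>" using 1 2 by auto
  have ue: "u \<bullet> e \<ge> 0"
  proof -
    have "u \<bullet> (s - p) \<ge> 0" using u(2) by (simp add: inner_diff_right)
    then show ?thesis using d unfolding e(2) by (simp add: zero_le_mult_iff)
  qed
  have qe: "q \<bullet> e \<le> d / 2"
  proof -
    have "sin \<zeta> \<le> sin Q" using zQ zb Qle al by (intro sin_monotone_2pi_le) auto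
    then show ?thesis using pol(1) polq(1) R by simp
  qed
  \<comment> \<open>In the frame \<open>q\<close> is above \<open>s\<close> and not to its right, so
    a negative \<open>u \<bullet> n\<close> would make \<open>q\<close> lower than \<open>s\<close>
    in direction \<open>u\<close>.\<close>
  have un: "u \<bullet> n \<ge> 0"
  proof (rule ccontr)
    assume "\<not> u \<bullet> n \<ge> 0"
    then have "(u \<bullet> n) * (q \<bullet> n + \<kappa>) < 0" using kap0 qn by (intro mult_neg_pos) auto
    moreover have "(u \<bullet> e) * (q \<bullet> e - d / 2) \<le> 0" using ue qe by (intro mult_nonneg_nonpos) auto
    moreover have "u \<bullet> q - u \<bullet> s = (u \<bullet> e) * (q \<bullet> e - d / 2) + (u \<bullet> n) * (q \<bullet> n + \<kappa>)"
      unfolding fr[of u q] fr[of u s] se sn by (simp add: \<kappa>_def algebra_simps)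
    ultimately show False using u(3) by linarith
  qed
  define \<psi> where "\<psi> = arcsin ((u \<bullet> e) / 1)"
  have uu: "(u \<bullet> e)\<^sup>2 + (u \<bullet> n)\<^sup>2 = 1\<^sup>2"
    using u(1) fr[of u u] by (simp add: power2_eq_square norm_eq_1)
  note polu = arcsin_polar[OF uu zero_less_one un, folded \<psi>_def]
  have ue1: "u \<bullet> e \<le> 1" using Cauchy_Schwarz_ineq2[of u e] u(1) e(1) by simp
  have psi: "0 \<le> \<psi>" "\<psi> \<le> pi / 2"
    using ue ue1 arcsin_le_arcsin[of 0 "u \<bullet> e"] arcsin_ubound[of "u \<bullet> e"] by (auto simp: \<psi>_def)
  show ?thesis
  proof (rule that[OF fr])
    show "p \<bullet> e = - R * sin Q" "p \<bullet> n = - R * cos Q" "s \<bullet> e = R * sin Q" "s \<bullet> n = - R * cos Q"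
      using pol pe se sn by (auto simp: \<kappa>_def)
    show "2 * \<alpha> \<le> Q" using zz by simp
  qed (use polq polu Qle zz psi in auto)
qed

section \<open>Trigonometric estimates\<close>

text \<open>The disks about \<open>(-w, 0)\<close> and \<open>(w, 0)\<close> meet in a lens with
  upper tip \<open>(0, \<tau>)\<close>, whose normal cone is spanned by \<open>(-w, \<tau>)\<close>
  and \<open>(w, \<tau>)\<close>. The condition on \<psi> places the direction
  \<open>(sin \<psi>, cos \<psi>)\<close> in this cone, so the tip is the highest point of the
  lens.\<close>

lemma lens_tip_bound:
  fixes x y w \<tau> \<rho> \<psi> :: real
  assumes "(x + w)\<^sup>2 + y\<^sup>2 \<le> \<rho>\<^sup>2" "(x - w)\<^sup>2 + y\<^sup>2 \<le> \<rho>\<^sup>2"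
    and "w\<^sup>2 + \<tau>\<^sup>2 = \<rho>\<^sup>2" "\<tau> > 0" "sin \<psi> * \<tau> \<le> cos \<psi> * w" "0 \<le> sin \<psi>" "0 \<le> cos \<psi>"
  shows "x * sin \<psi> + y * cos \<psi> \<le> \<tau> * cos \<psi>"
proof -
  have "(\<bar>x\<bar> + w)\<^sup>2 + y\<^sup>2 \<le> \<rho>\<^sup>2"
    using assms(1,2) by (cases "x \<ge> 0") (auto simp: power2_eq_square algebra_simps)
  then have "\<bar>x\<bar>\<^sup>2 + 2 * \<bar>x\<bar> * w + y\<^sup>2 \<le> \<tau>\<^sup>2"
    using assms(3) by (simp add: power2_sum)
  moreover have "2 * (y * \<tau>) \<le> y\<^sup>2 + \<tau>\<^sup>2" using sum_squares_bound[of y \<tau>] by simp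
  \<comment> \<open>This is the pair of tangent half-planes of the two disks at the tip.\<close>
  ultimately have 1: "\<bar>x\<bar> * w + y * \<tau> \<le> \<tau>\<^sup>2" using zero_le_power2[of "\<bar>x\<bar>"] by linarith
  have "\<tau> * (x * sin \<psi> + y * cos \<psi>) \<le> \<bar>x\<bar> * (sin \<psi> * \<tau>) + y * \<tau> * cos \<psi>"
    using mult_right_mono[OF abs_ge_self[of x], of "sin \<psi> * \<tau>"] assms(4,6) by (simp add: mult_ac distrib_left)
  also have "\<dots> \<le> \<bar>x\<bar> * (cos \<psi> * w) + y * \<tau> * cos \<psi>"
    using assms(5) by (intro add_right_mono mult_left_mono) auto
  also have "\<dots> = cos \<psi> * (\<bar>x\<bar> * w + y * \<tau>)" by (simp add: algebra_simps)
  also have "\<dots> \<le> cos \<psi> * \<tau>\<^sup>2" using 1 assms(7) by (intro mult_left_mono)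
  also have "\<dots> = \<tau> * (\<tau> * cos \<psi>)" by (simp add: power2_eq_square)
  finally show ?thesis using assms(4) by simp
qed

text \<open>The right-hand side is the height of \<open>q\<close> above \<open>p\<close>. The worst
  apex is \<open>\<zeta> = - (Q - 2 * \<alpha>)\<close>; the sum then factors, and the factor with
  \<open>Q\<close> is least at \<open>Q = pi / 2 - \<alpha>\<close>.\<close>

lemma breadth_at_steep_tilt:
  fixes R \<alpha> Q \<zeta> \<psi> :: real
  assumes "R > 0" "0 < \<alpha>" "2 * \<alpha> \<le> Q" "Q \<le> pi / 2 - \<alpha>" "\<bar>\<zeta>\<bar> \<le> Q - 2 * \<alpha>" "0 \<le> \<psi>" "\<psi> \<le> pi / 2"
  shows "2 * R * sin (2 * \<alpha>) * cos (\<alpha> - \<psi>) \<le> R * (cos (\<zeta> - \<psi>) + cos (Q - \<psi>))"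
proof -
  have "cos (Q + \<psi> - 2 * \<alpha>) \<le> cos \<bar>\<zeta> - \<psi>\<bar>" using assms by (intro cos_monotone_0_pi_le) auto
  then have z: "cos (Q + \<psi> - 2 * \<alpha>) \<le> cos (\<zeta> - \<psi>)" by simp
  have "cos (Q + \<psi> - 2 * \<alpha>) + cos (Q - \<psi>) = 2 * (cos (Q - \<alpha>) * cos (\<alpha> - \<psi>))"
    unfolding cos_times_cos by (simp add: algebra_simps)
  moreover have "sin (2 * \<alpha>) * cos (\<alpha> - \<psi>) \<le> cos (Q - \<alpha>) * cos (\<alpha> - \<psi>)"
  proof (rule mult_right_mono)
    have "sin (2 * \<alpha>) = cos (pi / 2 - 2 * \<alpha>)" by (simp add: sin_cos_eq)
    also have "\<dots> \<le> cos (Q - \<alpha>)" using assms by (intro cos_monotone_0_pi_le) auto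
    finally show "sin (2 * \<alpha>) \<le> cos (Q - \<alpha>)" .
    show "0 \<le> cos (\<alpha> - \<psi>)" using assms by (intro cos_ge_zero) auto
  qed
  ultimately have "2 * (sin (2 * \<alpha>) * cos (\<alpha> - \<psi>)) \<le> cos (\<zeta> - \<psi>) + cos (Q - \<psi>)"
    using z by linarith
  from mult_left_mono[OF this, of R] show ?thesis using assms(1) by (simp add: mult_ac)
qed

text \<open>The last hypothesis says that \<open>s q\<close> also has inclination at least \<alpha>.
  The height of \<open>q\<close> above \<open>p\<close> factors into the length of
  \<open>p q\<close> and the sine of its inclination, so for a fixed triangle only the two extreme
  tilts need checking.\<close>

lemma breadth_of_balanced_tilt:
  fixes R \<alpha> Q \<zeta> \<psi> :: real
  assumes "R > 0" "0 < \<alpha>" "2 * \<alpha> \<le> Q" "Q \<le> pi / 2 - \<alpha>" "\<bar>\<zeta>\<bar> \<le> Q - 2 * \<alpha>" "\<alpha> \<le> \<psi>" "\<psi> \<le> pi / 2"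
    and "(Q - \<zeta>) / 2 + \<psi> \<le> pi / 2 - \<alpha>"
  shows "2 * R * sin (2 * \<alpha>) \<le> R * (cos (\<zeta> - \<psi>) + cos (Q - \<psi>))"
proof -
  \<comment> \<open>The complement of the angle at \<open>p\<close>; that of the angle at
    \<open>s\<close> is \<open>Q - y\<close>.\<close>
  define y where "y = (Q + \<zeta>) / 2"
  have y: "\<alpha> \<le> y" "y \<le> Q - \<alpha>" "\<zeta> = 2 * y - Q" "Q - y + \<psi> \<le> pi / 2 - \<alpha>"
    using assms(5,8) by (auto simp: y_def field_simps)
  have prod: "cos (\<zeta> - \<psi>) + cos (Q - \<psi>) = 2 * (cos (y - \<psi>) * cos (Q - y))"
    unfolding cos_times_cos y(3) by (simp add: algebra_simps)
  have pos: "0 \<le> cos (Q - y)" using y assms by (intro cos_ge_zero) auto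
  have sins: "sin (2 * \<alpha>) \<le> sin t" if "2 * \<alpha> \<le> t" "t \<le> pi - 2 * \<alpha>" for t
  proof (cases "t \<le> pi / 2")
    case True
    then show ?thesis using that assms by (intro sin_monotone_2pi_le) auto
  next
    case False
    then have "sin (2 * \<alpha>) \<le> sin (pi - t)" using that assms by (intro sin_monotone_2pi_le) auto
    then show ?thesis by simp
  qed
  have "sin (2 * \<alpha>) \<le> cos (y - \<psi>) * cos (Q - y)"
  \<comment> \<open>The side \<open>p q\<close> is vertical at \<open>\<psi> = y\<close>. Up to
    there the worst tilt is \<open>\<psi> = \<alpha>\<close>; beyond it, the one at which
    \<open>s q\<close> has inclination \<alpha>.\<close>
  proof (cases "\<psi> \<le> y")
    case True
    have "cos (y - \<alpha>) \<le> cos (y - \<psi>)" using True y assms by (intro cos_monotone_0_pi_le) auto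
    then have le: "cos (y - \<alpha>) * cos (Q - y) \<le> cos (y - \<psi>) * cos (Q - y)" using pos by (intro mult_right_mono)
    have "sin (2 * \<alpha>) = cos (pi / 2 - 2 * \<alpha>)" by (simp add: sin_cos_eq)
    also have "\<dots> \<le> cos (Q - \<alpha>)" using assms by (intro cos_monotone_0_pi_le) auto
    finally have 1: "sin (2 * \<alpha>) \<le> cos (Q - \<alpha>)" .
    have "cos (Q - \<alpha>) \<le> cos \<bar>2 * y - \<alpha> - Q\<bar>" using y assms by (intro cos_monotone_0_pi_le) auto
    then have 2: "cos (Q - \<alpha>) \<le> cos (2 * y - \<alpha> - Q)" by simp
    have "2 * (cos (y - \<alpha>) * cos (Q - y)) = cos (2 * y - \<alpha> - Q) + cos (Q - \<alpha>)"
      unfolding cos_times_cos by (simp add: algebra_simps)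
    then show ?thesis using 1 2 le by linarith
  next
    case False
    have "sin (Q + \<alpha>) = cos (pi / 2 - (Q + \<alpha>))" by (simp add: sin_cos_eq[of "Q + \<alpha>"])
    also have "\<dots> \<le> cos (\<psi> - y)" using False y assms by (intro cos_monotone_0_pi_le) auto
    also have "\<dots> = cos (y - \<psi>)" by (metis cos_minus minus_diff_eq)
    finally have le: "sin (Q + \<alpha>) * cos (Q - y) \<le> cos (y - \<psi>) * cos (Q - y)" using pos by (intro mult_right_mono)
    have "2 * (sin (Q + \<alpha>) * cos (Q - y)) = sin (2 * Q - y + \<alpha>) + sin (y + \<alpha>)"
      unfolding sin_times_cos by (simp add: algebra_simps)
    moreover have "sin (2 * \<alpha>) \<le> sin (2 * Q - y + \<alpha>)" using y assms by (intro sins) auto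
    moreover have "sin (2 * \<alpha>) \<le> sin (y + \<alpha>)" using y assms by (intro sins) auto
    ultimately show ?thesis using le by linarith
  qed
  then show ?thesis unfolding prod using assms(1) by (simp add: mult_ac)
qed

text \<open>The function \<open>2 * D * sin \<alpha> * cos (\<alpha> - t) - \<rho> * sin (\<beta> +
  t)\<close> decreases in \<open>t\<close>. Sum-to-product formulas replace its derivative by the
  value at the midpoint \<open>m\<close>, where the coefficients of \<open>cos m\<close> and
  \<open>sin m\<close> are compared separately.\<close>

lemma shallow_tilt_comparison:
  fixes D \<rho> \<alpha> \<beta> \<delta> \<psi> :: real
  assumes "0 \<le> D" "0 \<le> \<alpha>" "\<alpha> \<le> pi / 6" "0 \<le> \<psi>" "\<psi> \<le> \<delta>" "\<delta> \<le> pi / 2"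
    and "\<rho> * cos \<beta> = D / 2" "\<rho> * sin \<beta> \<le> D * sin (2 * \<alpha>)"
  shows "2 * D * sin \<alpha> * cos (\<alpha> - \<delta>) + \<rho> * sin (\<beta> + \<psi>)
       \<le> 2 * D * sin \<alpha> * cos (\<alpha> - \<psi>) + \<rho> * sin (\<beta> + \<delta>)"
proof -
  define m where "m = (\<delta> + \<psi>) / 2"
  define l where "l = (\<delta> - \<psi>) / 2"
  have dl: "\<delta> = m + l" "\<psi> = m - l" by (auto simp: m_def l_def field_simps)
  have m: "0 \<le> cos m" "0 \<le> sin m" using assms(4-6) by (auto simp: m_def intro!: cos_ge_zero sin_ge_zero)
  have l: "0 \<le> sin l" using assms(4-6) by (auto simp: l_def intro!: sin_ge_zero)
  have "sin \<alpha> \<le> sin (pi / 6)" using assms(2,3) by (intro sin_monotone_2pi_le) auto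
  moreover have "0 \<le> sin \<alpha>" using assms(2,3) by (intro sin_ge_zero) auto
  ultimately have s: "sin \<alpha> * sin \<alpha> \<le> 1 / 2 * (1 / 2)" by (intro mult_mono) (auto simp: sin_30)
  have "2 * D * sin \<alpha> * sin (\<alpha> - m) = 2 * D * (sin \<alpha> * sin \<alpha>) * cos m - D * sin (2 * \<alpha>) * sin m"
    unfolding sin_diff sin_double by (simp add: algebra_simps)
  also have "\<dots> \<le> D / 2 * cos m - \<rho> * sin \<beta> * sin m"
  proof (intro diff_mono mult_right_mono m)
    show "2 * D * (sin \<alpha> * sin \<alpha>) \<le> D / 2" using mult_left_mono[OF s, of "2 * D"] assms(1) by simp
  qed (use assms(8) in auto)
  also have "\<dots> = \<rho> * cos (\<beta> + m)" unfolding assms(7)[symmetric] by (simp add: cos_add algebra_simps)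
  finally have "(2 * D * sin \<alpha> * sin (\<alpha> - m)) * (2 * sin l) \<le> (\<rho> * cos (\<beta> + m)) * (2 * sin l)"
    using l by (intro mult_right_mono) auto
  moreover have "\<rho> * sin (\<beta> + \<delta>) - \<rho> * sin (\<beta> + \<psi>) = (\<rho> * cos (\<beta> + m)) * (2 * sin l)"
  proof -
    have "sin (\<beta> + m + l) - sin (\<beta> + m - l) = 2 * (cos (\<beta> + m) * sin l)"
      unfolding sin_add[of "\<beta> + m" l] sin_diff[of "\<beta> + m" l] by simp
    then show ?thesis unfolding dl right_diff_distrib[symmetric] by (simp add: add.assoc add_diff_eq)
  qed
  moreover have "2 * D * sin \<alpha> * cos (\<alpha> - \<delta>) - 2 * D * sin \<alpha> * cos (\<alpha> - \<psi>)
      = (2 * D * sin \<alpha> * sin (\<alpha> - m)) * (2 * sin l)"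
  proof -
    have "cos (\<alpha> - m - l) - cos (\<alpha> - m + l) = 2 * (sin (\<alpha> - m) * sin l)"
      unfolding cos_add[of "\<alpha> - m" l] cos_diff[of "\<alpha> - m" l] by simp
    then show ?thesis unfolding dl right_diff_distrib[symmetric] by (simp add: diff_diff_eq diff_diff_eq2 diff_add_eq)
  qed
  ultimately show ?thesis by linarith
qed

text \<open>A lens of two disks of radius \<open>\<rho>\<close>, centred at the ends of a chord of half-angle \<open>Q\<close> of a circle of
  radius \<open>R\<close>, has its tip at height \<open>\<tau> - R * cos Q\<close> above the centre of that circle. This is
  largest for the longest admissible chord, \<open>Q = pi / 2 - \<alpha>\<close>.\<close>

lemma lens_height_mono:
  fixes R \<rho> \<alpha> Q \<psi> \<tau> \<kappa> :: real
  assumes "0 < R" "R \<le> \<rho>" "0 < \<alpha>" "0 \<le> \<psi>" "\<psi> \<le> pi / 2" "2 * \<alpha> \<le> Q" "Q \<le> pi / 2 - \<alpha>"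
    and \<tau>: "\<tau> = sqrt (\<rho>\<^sup>2 - (R * sin Q)\<^sup>2)" and \<kappa>: "\<kappa> = sqrt (\<rho>\<^sup>2 - (R * cos \<alpha>)\<^sup>2)"
  shows "R * sin \<alpha> - \<kappa> \<le> R * cos Q - \<tau>"
proof -
  have "sin Q \<le> sin (pi / 2 - \<alpha>)" using assms by (intro sin_monotone_2pi_le) auto
  then have sQ: "0 \<le> sin Q" "sin Q \<le> cos \<alpha>" using assms by (auto simp: sin_diff intro!: sin_ge_zero)
  have "cos (pi / 2 - \<alpha>) \<le> cos Q" using assms by (intro cos_monotone_0_pi_le) auto
  then have cQ: "sin \<alpha> \<le> cos Q" by (simp add: cos_diff)
  have s0: "0 < sin \<alpha>" using assms by (intro sin_gt_zero) auto
  have ca: "0 \<le> cos \<alpha>" using sQ by linarith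
  have rho: "R\<^sup>2 \<le> \<rho>\<^sup>2" using assms by (intro power_mono) auto
  have bd: "(R * x)\<^sup>2 \<le> \<rho>\<^sup>2" if "0 \<le> x" "x \<le> 1" for x
    using that rho by (simp add: power_mult_distrib) (meson dual_order.trans mult_right_le_one_le power_le_one zero_le_power2)
  have t2: "\<tau>\<^sup>2 = \<rho>\<^sup>2 - (R * sin Q)\<^sup>2" and k2: "\<kappa>\<^sup>2 = \<rho>\<^sup>2 - (R * cos \<alpha>)\<^sup>2"
    using bd[of "sin Q"] bd[of "cos \<alpha>"] sQ ca by (auto simp: \<tau> \<kappa>)
  have tk: "\<kappa> \<le> \<tau>" "0 \<le> \<kappa>"
  proof -
    show "\<kappa> \<le> \<tau>" unfolding \<tau> \<kappa> using sQ assms(1) by (intro real_sqrt_le_mono diff_left_mono power_mono mult_left_mono) auto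
    show "0 \<le> \<kappa>" unfolding \<kappa> using bd[of "cos \<alpha>"] ca by simp
  qed
  \<comment> \<open>The line through the circumcentre along the axis of the lens meets the circle of
    radius \<rho> about an end of the chord in two points. The product of their distances is a power
    of a point, independent of \<open>Q\<close>; as one factor grows with the chord shortened, the
    other shrinks.\<close>
  have e1: "(\<tau> - R * cos Q) * (\<tau> + R * cos Q) = \<rho>\<^sup>2 - R\<^sup>2"
  proof -
    have "(\<tau> - R * cos Q) * (\<tau> + R * cos Q) = \<tau>\<^sup>2 - R\<^sup>2 * (cos Q)\<^sup>2"
      by (simp add: power2_eq_square algebra_simps)
    also have "\<dots> = \<rho>\<^sup>2 - R\<^sup>2 * ((sin Q)\<^sup>2 + (cos Q)\<^sup>2)"
      unfolding t2 by (simp only: power_mult_distrib distrib_left diff_diff_eq)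
    finally show ?thesis by simp
  qed
  have e2: "(\<kappa> - R * sin \<alpha>) * (\<kappa> + R * sin \<alpha>) = \<rho>\<^sup>2 - R\<^sup>2"
  proof -
    have "(\<kappa> - R * sin \<alpha>) * (\<kappa> + R * sin \<alpha>) = \<kappa>\<^sup>2 - R\<^sup>2 * (sin \<alpha>)\<^sup>2"
      by (simp add: power2_eq_square algebra_simps)
    also have "\<dots> = \<rho>\<^sup>2 - R\<^sup>2 * ((cos \<alpha>)\<^sup>2 + (sin \<alpha>)\<^sup>2)"
      unfolding k2 by (simp only: power_mult_distrib distrib_left diff_diff_eq)
    finally show ?thesis by simp
  qed
  have pos: "0 < \<kappa> + R * sin \<alpha>" using tk s0 assms(1) by (simp add: add_nonneg_pos)
  have le: "\<kappa> + R * sin \<alpha> \<le> \<tau> + R * cos Q" using tk cQ assms(1) by (intro add_mono mult_left_mono) auto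
  have nn: "0 \<le> \<tau> - R * cos Q" using e1 rho pos le by (metis diff_ge_0_iff_ge less_le_trans zero_le_mult_iff not_le)
  have "(\<tau> - R * cos Q) * (\<kappa> + R * sin \<alpha>) \<le> (\<tau> - R * cos Q) * (\<tau> + R * cos Q)"
    using nn le by (intro mult_left_mono)
  also have "\<dots> = (\<kappa> - R * sin \<alpha>) * (\<kappa> + R * sin \<alpha>)" using e1 e2 by simp
  finally show ?thesis using pos by (simp add: mult_le_cancel_right)
qed

section \<open>Breadth of a triangle together with a disk\<close>

text \<open>Here and below the origin is the circumcentre, \<open>c\<close> the incentre, \<open>u\<close> the direction in
  which the breadth \<open>f\<close> is measured, and \<open>\<psi>\<close> the inclination of the side \<open>p s\<close>.\<close>

lemma breadth_bound_shallow_tilt: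
  fixes p q s c u e n :: "real^2"
  assumes pos: "0 < R" "0 < \<alpha>" "0 \<le> r" "2 * r \<le> D" "R \<le> D - r" and D: "D = 2 * R * cos \<alpha>"
    and frame: "\<And>x y. x \<bullet> y = (x \<bullet> e) * (y \<bullet> e) + (x \<bullet> n) * (y \<bullet> n)"
    and p: "p \<bullet> e = - R * sin Q" "p \<bullet> n = - R * cos Q"
    and s: "s \<bullet> e = R * sin Q" "s \<bullet> n = - R * cos Q"
    and q: "q \<bullet> e = R * sin \<zeta>" "q \<bullet> n = R * cos \<zeta>"
    and u: "u \<bullet> e = sin \<psi>" "u \<bullet> n = cos \<psi>"
    and ranges: "2 * \<alpha> \<le> Q" "Q \<le> pi / 2 - \<alpha>" "\<bar>\<zeta>\<bar> \<le> Q - 2 * \<alpha>" "0 \<le> \<psi>" "\<psi> < \<alpha>"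
    and c: "norm (c - p) \<le> D - r" "norm (c - s) \<le> D - r"
    and f: "u \<bullet> q - u \<bullet> p \<le> f" "u \<bullet> q - u \<bullet> c + r \<le> f" "2 * r \<le> f"
  shows "2 * D * sin \<alpha> * cos (arccos (D / (2 * (D - r))) + \<alpha> - arcsin (r / (D - r))) \<le> f"
proof -
  define \<rho> where "\<rho> = D - r"
  define \<beta> where "\<beta> = arccos (D / (2 * \<rho>))"
  define \<gamma> where "\<gamma> = arcsin (r / \<rho>)"
  have rho: "0 < \<rho>" "R \<le> \<rho>" using pos by (auto simp: \<rho>_def)
  have al: "\<alpha> \<le> pi / 6" using ranges by simp
  have D0: "0 < D" using pos rho by (simp add: \<rho>_def)
  have sa: "0 < sin \<alpha>" using pos al by (intro sin_gt_zero) auto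
  have bb: "0 \<le> D / (2 * \<rho>)" "D / (2 * \<rho>) \<le> 1"
    using rho pos D0 by (auto simp: \<rho>_def field_simps)
  have beta: "0 \<le> \<beta>" "\<beta> \<le> pi / 2" "\<rho> * cos \<beta> = D / 2"
    using bb rho arccos_lbound[of "D / (2 * \<rho>)"] arccos_le_arccos[of 0 "D / (2 * \<rho>)"]
    by (auto simp: \<beta>_def)
  have gg: "0 \<le> r / \<rho>" "r / \<rho> \<le> 1" using rho pos by (auto simp: \<rho>_def field_simps)
  have gamma: "0 \<le> \<gamma>" "\<gamma> \<le> pi / 2" "\<rho> * sin \<gamma> = r"
    using gg rho arcsin_le_arcsin[of 0 "r / \<rho>"] arcsin_ubound[of "r / \<rho>"] by (auto simp: \<gamma>_def)
  have uq: "u \<bullet> q = R * cos (\<zeta> - \<psi>)"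
    unfolding frame[of u q] u q cos_diff by (simp add: algebra_simps)
  have up: "u \<bullet> p = - R * cos (Q - \<psi>)"
    unfolding frame[of u p] u p cos_diff by (simp add: algebra_simps)
  have "2 * D * sin \<alpha> * cos (\<beta> + \<alpha> - \<gamma>) \<le> f"
  proof (cases "\<gamma> - \<beta> \<le> \<psi>")
    case True
    have "cos (\<beta> + \<alpha> - \<gamma>) \<le> cos (\<alpha> - \<psi>)"
      using True ranges al beta gamma by (intro cos_monotone_0_pi_le) auto
    then have "2 * D * sin \<alpha> * cos (\<beta> + \<alpha> - \<gamma>) \<le> 2 * D * sin \<alpha> * cos (\<alpha> - \<psi>)"
      using D0 sa by (intro mult_left_mono) auto
    also have "\<dots> = 2 * R * sin (2 * \<alpha>) * cos (\<alpha> - \<psi>)" by (simp add: D sin_double)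
    also have "\<dots> \<le> R * (cos (\<zeta> - \<psi>) + cos (Q - \<psi>))"
      using pos ranges al by (intro breadth_at_steep_tilt) auto
    also have "\<dots> \<le> f" using f(1) unfolding uq up by (simp add: algebra_simps)
    finally show ?thesis .
  next
    case False
    show ?thesis
    \<comment> \<open>The negated bound, together with \<open>2 * r \<le> f\<close>, yields
      \<open>r < D * sin \<alpha>\<close>. This supplies the numerical control of \<alpha> needed
      below.\<close>
    proof (rule ccontr)
      assume "\<not> ?thesis"
      then have flt: "f < 2 * D * sin \<alpha> * cos (\<beta> + \<alpha> - \<gamma>)" by simp
      also have "\<dots> \<le> 2 * D * sin \<alpha> * 1" using D0 sa by (intro mult_left_mono) auto
      finally have r_lt: "r < D * sin \<alpha>" using f(3) by simp
      \<comment> \<open>The height of the lens tip above a chord of the extreme length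
        \<open>D\<close>.\<close>
      define k where "k = \<rho> * sin \<beta>"
      have k2: "k\<^sup>2 = \<rho>\<^sup>2 - (D / 2)\<^sup>2"
        unfolding k_def beta(3)[symmetric] by (simp add: power_mult_distrib sin_squared_eq algebra_simps)
      have k0: "0 \<le> k" using rho beta unfolding k_def by (intro mult_nonneg_nonneg sin_ge_zero) auto
      have "sin \<beta> < sin \<gamma>" using False ranges beta gamma by (intro sin_monotone_2pi) auto
      then have "k < r" using rho unfolding k_def gamma(3)[symmetric] by simp
      then have "k\<^sup>2 < r\<^sup>2" using k0 by (intro power_strict_mono) auto
      \<comment> \<open>The constant 3/8 comes from expanding
        \<open>(D - r)^2 - (D / 2)^2 < r^2\<close>.\<close>
      then have "D * (3 * D) < D * (8 * r)"
        unfolding k2 \<rho>_def by (simp add: power2_eq_square algebra_simps)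
      then have r38: "3 / 8 * D < r" using D0 by simp
      have Ds: "3 / 8 * D < D * sin \<alpha>" using r_lt r38 by simp
      then have sa38: "3 / 8 < sin \<alpha>" using D0 by simp
      have "sin \<psi> \<le> sin (pi / 6)" using ranges al by (intro sin_monotone_2pi_le) auto
      then have sp: "0 \<le> sin \<psi>" "sin \<psi> \<le> 1 / 2"
        using ranges al by (auto simp: sin_30 intro!: sin_ge_zero)
      have ca: "3 / 4 \<le> cos x" if "0 \<le> x" "x \<le> pi / 6" for x
      proof -
        have "(3 / 2)\<^sup>2 \<le> (3::real)" by (simp add: power2_eq_square)
        then have "3 / 2 \<le> sqrt 3" by (rule real_le_rsqrt)
        moreover have "cos (pi / 6) \<le> cos x" using that by (intro cos_monotone_0_pi_le) auto
        ultimately show ?thesis by (simp add: cos_30)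
      qed
      have rho58: "\<rho> \<le> 5 / 8 * D" using r38 by (simp add: \<rho>_def)
      \<comment> \<open>With \<open>\<rho> \<le> 5 / 8 * D\<close> and the half chord
        \<open>D / 2\<close> this is the 3-4-5 triangle. The same triangle bounds \<tau> by
        \<open>D / 2\<close> once \<open>w \<ge> 3 / 8 * D\<close>.\<close>
      have "k \<le> 3 / 8 * D"
      proof (rule power2_le_imp_le)
        have "\<rho>\<^sup>2 \<le> (5 / 8 * D)\<^sup>2" using rho58 rho by (intro power_mono) auto
        then show "k\<^sup>2 \<le> (3 / 8 * D)\<^sup>2" unfolding k2 by (simp add: power2_eq_square algebra_simps)
      qed (use D0 in simp)
      also have "3 / 8 * D \<le> D * sin (2 * \<alpha>)"
      proof -
        have "3 / 8 * (3 / 4) \<le> sin \<alpha> * cos \<alpha>" using sa38 ca[of \<alpha>] pos al by (intro mult_mono) auto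
        then have "3 / 8 \<le> sin (2 * \<alpha>)" by (simp add: sin_double)
        then show ?thesis using D0 by simp
      qed
      finally have kle: "\<rho> * sin \<beta> \<le> D * sin (2 * \<alpha>)" unfolding k_def .
      \<comment> \<open>Half the length of \<open>p s\<close>; \<tau> is the height of the lens tip
        above this side.\<close>
      define w where "w = R * sin Q"
      define \<tau> where "\<tau> = sqrt (\<rho>\<^sup>2 - w\<^sup>2)"
      have sQ: "sin (2 * \<alpha>) \<le> sin Q" using pos ranges by (intro sin_monotone_2pi_le) auto
      have cQ: "0 < cos Q" using pos ranges by (intro cos_gt_zero_pi) auto
      have "D * sin \<alpha> = R * sin (2 * \<alpha>)" by (simp add: D sin_double)
      also have "\<dots> \<le> w" unfolding w_def using sQ pos by simp
      finally have w38: "3 / 8 * D \<le> w" using Ds by linarith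
      have "w\<^sup>2 < \<rho>\<^sup>2"
      proof -
        have "w\<^sup>2 + (R * cos Q)\<^sup>2 = R\<^sup>2 * ((sin Q)\<^sup>2 + (cos Q)\<^sup>2)"
          unfolding w_def by (simp only: power_mult_distrib distrib_left)
        then have "w\<^sup>2 + (R * cos Q)\<^sup>2 = R\<^sup>2" by simp
        moreover have "0 < (R * cos Q)\<^sup>2" using cQ pos by simp
        moreover have "R\<^sup>2 \<le> \<rho>\<^sup>2" using rho pos by (intro power_mono) auto
        ultimately show ?thesis by linarith
      qed
      then have tau: "0 < \<tau>" "w\<^sup>2 + \<tau>\<^sup>2 = \<rho>\<^sup>2" by (auto simp: \<tau>_def)
      have tau_le: "\<tau> \<le> D / 2"
      proof (rule power2_le_imp_le)
        have "\<rho>\<^sup>2 \<le> (5 / 8 * D)\<^sup>2" using rho58 rho by (intro power_mono) auto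
        moreover have "(3 / 8 * D)\<^sup>2 \<le> w\<^sup>2" using w38 D0 by (intro power_mono) auto
        ultimately show "\<tau>\<^sup>2 \<le> (D / 2)\<^sup>2" using tau(2) by (simp add: power2_eq_square algebra_simps)
      qed (use D0 in simp)
      \<comment> \<open>The crude bounds leave \<open>1 / 4 * D\<close> against
        \<open>9 / 32 * D\<close>, which suffices for the normal cone condition at the tip.\<close>
      have in_cone: "sin \<psi> * \<tau> \<le> cos \<psi> * w"
      proof -
        have "sin \<psi> * \<tau> \<le> 1 / 2 * (D / 2)" using sp tau_le tau D0 by (intro mult_mono) auto
        also have "\<dots> \<le> 3 / 4 * (3 / 8 * D)" using D0 by simp
        also have "\<dots> \<le> cos \<psi> * w" using ca[of \<psi>] ranges al w38 D0 by (intro mult_mono) auto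
        finally show ?thesis .
      qed
      have near: "(x \<bullet> e)\<^sup>2 + (x \<bullet> n)\<^sup>2 \<le> \<rho>\<^sup>2" if "norm x \<le> D - r" for x
      proof -
        have "(norm x)\<^sup>2 \<le> \<rho>\<^sup>2" using that unfolding \<rho>_def by (intro power_mono) auto
        then show ?thesis
          unfolding power2_norm_eq_inner frame[of x x] by (simp only: power2_eq_square)
      qed
      \<comment> \<open>The origin moves to the midpoint of \<open>p s\<close>, which puts the disk
        centres at \<open>(-w, 0)\<close> and \<open>(w, 0)\<close>.\<close>
      define y where "y = c \<bullet> n + R * cos Q"
      have "(c \<bullet> e + w)\<^sup>2 + y\<^sup>2 \<le> \<rho>\<^sup>2" "(c \<bullet> e - w)\<^sup>2 + y\<^sup>2 \<le> \<rho>\<^sup>2"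
        using near[OF c(1)] near[OF c(2)] by (simp_all add: inner_diff_left p s w_def y_def)
      then have "(c \<bullet> e) * sin \<psi> + y * cos \<psi> \<le> \<tau> * cos \<psi>"
        using tau in_cone sp ca[of \<psi>] ranges al by (intro lens_tip_bound[where w = w and \<rho> = \<rho>]) auto
      moreover have "u \<bullet> c = (c \<bullet> e) * sin \<psi> + y * cos \<psi> - R * cos Q * cos \<psi>"
        unfolding frame[of u c] u y_def by (simp add: algebra_simps)
      ultimately have uc: "u \<bullet> c \<le> - ((R * cos Q - \<tau>) * cos \<psi>)" by (simp add: algebra_simps)
      have k_eq: "k = sqrt (\<rho>\<^sup>2 - (R * cos \<alpha>)\<^sup>2)"
        using k2 k0 by (simp add: D real_sqrt_unique)
      have "(R * sin \<alpha> - k) * cos \<psi> \<le> (R * cos Q - \<tau>) * cos \<psi>"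
        using lens_height_mono[OF pos(1) rho(2) pos(2) ranges(4) _ ranges(1,2) \<tau>_def[unfolded w_def] k_eq]
          ca[of \<psi>] ranges al by (intro mult_right_mono) auto
      then have uc': "u \<bullet> c \<le> - ((R * sin \<alpha> - k) * cos \<psi>)" using uc by linarith
      \<comment> \<open>The lowest possible \<open>q\<close>: the extreme values are
        \<open>Q = pi / 2 - \<alpha>\<close> and
        \<open>\<zeta> = - (pi / 2 - 3 * \<alpha>)\<close>.\<close>
      have "cos (pi / 2 - (3 * \<alpha> - \<psi>)) \<le> cos \<bar>\<zeta> - \<psi>\<bar>"
        using ranges pos by (intro cos_monotone_0_pi_le) auto
      then have "sin (3 * \<alpha> - \<psi>) \<le> cos (\<zeta> - \<psi>)" by (simp add: sin_cos_eq[of "3 * \<alpha> - \<psi>"])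
      then have "R * sin (3 * \<alpha> - \<psi>) \<le> u \<bullet> q" unfolding uq using pos by simp
      moreover have "R * sin (3 * \<alpha> - \<psi>) + R * sin \<alpha> * cos \<psi>
          = 2 * D * sin \<alpha> * cos (\<alpha> - \<psi>) - D / 2 * sin \<psi>"
      proof -
        have "sin (3 * \<alpha> - \<psi>) + sin (\<alpha> + \<psi>) = 2 * (sin (2 * \<alpha>) * cos (\<alpha> - \<psi>))"
          unfolding sin_times_cos by (simp add: algebra_simps)
        then have "R * sin (3 * \<alpha> - \<psi>) + R * sin (\<alpha> + \<psi>) = 2 * R * sin (2 * \<alpha>) * cos (\<alpha> - \<psi>)"
          by (simp flip: distrib_left)
        then show ?thesis unfolding sin_double[of \<alpha>] sin_add D by (simp add: algebra_simps)
      qed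
      moreover have "\<rho> * sin (\<beta> + \<psi>) = k * cos \<psi> + D / 2 * sin \<psi>"
        unfolding k_def beta(3)[symmetric] sin_add by (simp add: algebra_simps)
      ultimately have "2 * D * sin \<alpha> * cos (\<alpha> - \<psi>) - \<rho> * sin (\<beta> + \<psi>) + r \<le> f"
        using f(2) uc' by (simp add: algebra_simps)
      \<comment> \<open>At the threshold tilt \<open>\<gamma> - \<beta>\<close> the term
        \<open>\<rho> * sin \<gamma>\<close> equals \<open>r\<close> and cancels the inball radius,
        leaving exactly the claimed bound.\<close>
      moreover have "2 * D * sin \<alpha> * cos (\<alpha> - (\<gamma> - \<beta>)) + \<rho> * sin (\<beta> + \<psi>)
          \<le> 2 * D * sin \<alpha> * cos (\<alpha> - \<psi>) + \<rho> * sin (\<beta> + (\<gamma> - \<beta>))"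
        using D0 pos al ranges False beta gamma kle by (intro shallow_tilt_comparison) auto
      ultimately show False using flt gamma(3) by (simp add: algebra_simps)
    qed
  qed
  then show ?thesis unfolding \<beta>_def \<gamma>_def \<rho>_def .
qed

text \<open>Replacing \<open>u\<close> by \<open>- u\<close> exchanges \<open>p\<close> with
  \<open>q\<close> and makes \<open>s q\<close> the lower side, so a shallow side on either end
  reduces to the preceding estimate. If neither side is shallow, the triangle alone
  suffices.\<close>

lemma breadth_bound:
  fixes p q s c u :: "real^2"
  assumes pos: "0 < R" "0 < \<alpha>" "\<alpha> < pi / 2" "0 \<le> r" "2 * r \<le> D" "R \<le> D - r" and D: "D = 2 * R * cos \<alpha>"
    and on_circle: "norm p = R" "norm q = R" "norm s = R"
    and sides: "dist p q \<le> D" "dist q s \<le> D" "dist p s \<le> D"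
    and hull: "0 \<le> a" "0 \<le> b" "0 \<le> b'" "a + b + b' = 1" "a *\<^sub>R p + b *\<^sub>R q + b' *\<^sub>R s = 0"
    and u: "norm u = 1" "u \<bullet> p \<le> u \<bullet> s" "u \<bullet> s \<le> u \<bullet> q"
    and c: "norm (c - p) \<le> D - r" "norm (c - q) \<le> D - r" "norm (c - s) \<le> D - r"
    and f: "u \<bullet> q - u \<bullet> p \<le> f" "u \<bullet> q - u \<bullet> c + r \<le> f" "u \<bullet> c - u \<bullet> p + r \<le> f" "2 * r \<le> f"
  shows "2 * D * sin \<alpha> * cos (arccos (D / (2 * (D - r))) + \<alpha> - arcsin (r / (D - r))) \<le> f"
    (is "?L \<le> f")
proof -
  obtain e n Q \<zeta> \<psi> where fr: "\<And>x y. x \<bullet> y = (x \<bullet> e) * (y \<bullet> e) + (x \<bullet> n) * (y \<bullet> n)"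
    and pe: "p \<bullet> e = - R * sin Q" and pn: "p \<bullet> n = - R * cos Q"
    and se: "s \<bullet> e = R * sin Q" and sn: "s \<bullet> n = - R * cos Q"
    and qe: "q \<bullet> e = R * sin \<zeta>" and qn: "q \<bullet> n = R * cos \<zeta>"
    and ue: "u \<bullet> e = sin \<psi>" and un: "u \<bullet> n = cos \<psi>"
    and ra: "2 * \<alpha> \<le> Q" "Q \<le> pi / 2 - \<alpha>" "\<bar>\<zeta>\<bar> \<le> Q - 2 * \<alpha>" "0 \<le> \<psi>" "\<psi> \<le> pi / 2"
    using triangle_frame[OF pos(1-3) on_circle sides[unfolded D] hull(5) hull(1-4) u] by metis
  have hull': "b *\<^sub>R q + a *\<^sub>R p + b' *\<^sub>R s = 0" "b + a + b' = 1" using hull by (auto simp: ac_simps)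
  have u': "norm (- u) = 1" "- u \<bullet> q \<le> - u \<bullet> s" "- u \<bullet> s \<le> - u \<bullet> p" using u by auto
  have sides': "dist q p \<le> D" "dist p s \<le> D" "dist q s \<le> D" using sides by (auto simp: dist_commute)
  obtain e' n' Q' \<zeta>' \<psi>' where fr': "\<And>x y. x \<bullet> y = (x \<bullet> e') * (y \<bullet> e') + (x \<bullet> n') * (y \<bullet> n')"
    and qe': "q \<bullet> e' = - R * sin Q'" and qn': "q \<bullet> n' = - R * cos Q'"
    and se': "s \<bullet> e' = R * sin Q'" and sn': "s \<bullet> n' = - R * cos Q'"
    and pe': "p \<bullet> e' = R * sin \<zeta>'" and pn': "p \<bullet> n' = R * cos \<zeta>'"
    and ue': "- u \<bullet> e' = sin \<psi>'" and un': "- u \<bullet> n' = cos \<psi>'"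
    and ra': "2 * \<alpha> \<le> Q'" "Q' \<le> pi / 2 - \<alpha>" "\<bar>\<zeta>'\<bar> \<le> Q' - 2 * \<alpha>" "0 \<le> \<psi>'" "\<psi>' \<le> pi / 2"
    using triangle_frame[OF pos(1-3) on_circle(2,1,3) sides'[unfolded D] hull'(1) hull(2,1,3) hull'(2) u'] by metis
  consider "\<psi> < \<alpha>" | "\<psi>' < \<alpha>" | "\<alpha> \<le> \<psi>" "\<alpha> \<le> \<psi>'" by linarith
  then show ?thesis
  proof cases
    case 1
    show ?thesis
      by (rule breadth_bound_shallow_tilt[OF pos(1,2,4-6) D fr pe pn se sn qe qn ue un ra(1-4) 1 c(1,3) f(1,2,4)])
  next
    case 2
    have f': "- u \<bullet> p - - u \<bullet> q \<le> f" "- u \<bullet> p - - u \<bullet> c + r \<le> f" using f by auto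
    show ?thesis
      by (rule breadth_bound_shallow_tilt[OF pos(1,2,4-6) D fr' qe' qn' se' sn' pe' pn' ue' un' ra'(1-4) 2 c(2,3) f' f(4)])
  next
    case 3
    \<comment> \<open>The two frames are related by computing the same quantities in both:
      \<open>q \<bullet> s\<close> identifies \<open>Q'\<close> as the angle at \<open>p\<close>,
      and the height of \<open>q\<close> above \<open>s\<close> then expresses the inclination
      \<open>\<psi>'\<close> through \<psi>.\<close>
    have "q \<bullet> s = R\<^sup>2 * - cos (Q + \<zeta>)"
      unfolding fr[of q s] qe qn se sn by (simp add: cos_add power2_eq_square algebra_simps)
    moreover have "q \<bullet> s = R\<^sup>2 * cos (2 * Q')"
      unfolding fr'[of q s] qe' qn' se' sn' cos_double by (simp add: power2_eq_square algebra_simps)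
    ultimately have "R\<^sup>2 * cos (2 * Q') = R\<^sup>2 * - cos (Q + \<zeta>)" by simp
    then have "cos (2 * Q') = cos (pi - (Q + \<zeta>))" using pos(1) unfolding mult_cancel_left by simp
    then have "2 * Q' = pi - (Q + \<zeta>)" using ra ra' pos by (intro cos_inj_pi[of "2 * Q'"]) auto
    then have Q': "Q' = pi / 2 - (Q + \<zeta>) / 2" by (simp add: field_simps)
    have sQ': "sin Q' = cos ((Q + \<zeta>) / 2)" unfolding Q' by (simp add: cos_sin_eq)
    have "sin Q' > 0" using ra' pos by (intro sin_gt_zero) auto
    have "u \<bullet> q - u \<bullet> s = R * (cos (\<zeta> - \<psi>) + cos (Q + \<psi>))"
      unfolding fr[of u q] fr[of u s] qe qn se sn ue un by (simp add: cos_add cos_diff algebra_simps)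
    also have "\<dots> = 2 * R * (cos ((Q + \<zeta>) / 2) * cos ((Q - \<zeta>) / 2 + \<psi>))"
    proof -
      have half: "(Q + \<zeta>) / 2 - ((Q - \<zeta>) / 2 + \<psi>) = \<zeta> - \<psi>" "(Q + \<zeta>) / 2 + ((Q - \<zeta>) / 2 + \<psi>) = Q + \<psi>"
        by (auto simp: field_simps)
      show ?thesis unfolding cos_times_cos half by simp
    qed
    finally have 1: "u \<bullet> q - u \<bullet> s = 2 * R * (cos ((Q + \<zeta>) / 2) * cos ((Q - \<zeta>) / 2 + \<psi>))" .
    have "- u \<bullet> s - - u \<bullet> q = 2 * R * (sin Q' * sin \<psi>')"
      unfolding fr'[of "- u" q] fr'[of "- u" s] qe' qn' se' sn' ue' un' by (simp add: algebra_simps)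
    then have "cos ((Q - \<zeta>) / 2 + \<psi>) = sin \<psi>'"
      using 1 \<open>sin Q' > 0\<close> pos(1) unfolding sQ' by simp
    then have cos_eq: "cos ((Q - \<zeta>) / 2 + \<psi>) = cos (pi / 2 - \<psi>')" by (simp add: sin_cos_eq)
    have "0 \<le> (Q - \<zeta>) / 2" "(Q - \<zeta>) / 2 \<le> Q" using ra pos by auto
    then have "0 \<le> (Q - \<zeta>) / 2 + \<psi>" "(Q - \<zeta>) / 2 + \<psi> \<le> pi"
      "0 \<le> pi / 2 - \<psi>'" "pi / 2 - \<psi>' \<le> pi"
      by - (use ra(1,2,4,5) ra'(4,5) pos(2) in linarith)+
    from cos_inj_pi[OF this cos_eq] have "(Q - \<zeta>) / 2 + \<psi> = pi / 2 - \<psi>'" .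
    then have "2 * R * sin (2 * \<alpha>) \<le> R * (cos (\<zeta> - \<psi>) + cos (Q - \<psi>))"
      using 3 ra pos by (intro breadth_of_balanced_tilt) auto
    also have "\<dots> = u \<bullet> q - u \<bullet> p"
      unfolding fr[of u q] fr[of u p] qe qn pe pn ue un by (simp add: cos_diff algebra_simps)
    finally have "2 * D * sin \<alpha> \<le> f" using f(1) unfolding D sin_double by (simp add: mult_ac)
    moreover have "?L \<le> 2 * D * sin \<alpha> * 1"
      using pos by (intro mult_left_mono mult_nonneg_nonneg sin_ge_zero) auto
    ultimately show ?thesis by simp
  qed
qed

section \<open>Circumball and inball\<close>

text \<open>The infimum is attained by compactness: centres of enclosing balls with radii tending to
  it stay close to a fixed point of \<open>K\<close>, and a limit of them serves as centre.\<close>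

lemma circumball_exists:
  fixes K :: "(real^2) set"
  assumes "compact K" "K \<noteq> {}"
  obtains z where "K \<subseteq> cball z (circumradius K)" "0 \<le> circumradius K"
    "\<And>c r. K \<subseteq> cball c r \<Longrightarrow> circumradius K \<le> r"
proof -
  define A where "A = {r. \<exists>c. K \<subseteq> cball c r}"
  have R: "circumradius K = Inf A" by (simp add: circumradius_def A_def)
  obtain k where k: "k \<in> K" using assms(2) by blast
  have A0: "0 \<le> r" if "r \<in> A" for r
  proof -
    obtain c where "K \<subseteq> cball c r" using \<open>r \<in> A\<close> by (auto simp: A_def)
    then have "dist c k \<le> r" using k by auto
    then show ?thesis using zero_le_dist[of c k] by linarith
  qed
  have bdd: "bdd_below A" using A0 by (intro bdd_belowI)
  have ne: "A \<noteq> {}"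
    using compact_imp_bounded[OF assms(1)] by (auto simp: A_def bounded_subset_cball)
  have "\<exists>c. K \<subseteq> cball c (Inf A + inverse (real (Suc n)))" for n
  proof -
    obtain r where "r \<in> A" "r < Inf A + inverse (real (Suc n))"
      using cInf_lessD[OF ne, of "Inf A + inverse (real (Suc n))"] by auto
    then show ?thesis unfolding A_def
      by (smt (verit, ccfv_SIG) mem_Collect_eq subset_cball subset_trans)
  qed
  then obtain c where c: "\<And>n. K \<subseteq> cball (c n) (Inf A + inverse (real (Suc n)))" by metis
  have "c n \<in> cball k (Inf A + 1)" for n
  proof -
    have "dist (c n) k \<le> Inf A + inverse (real (Suc n))" using c[of n] k by auto
    moreover have "inverse (real (Suc n)) \<le> 1" by (simp add: inverse_le_1_iff)
    ultimately show ?thesis by (simp add: dist_commute)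
  qed
  then obtain z g where g: "strict_mono g" "(c \<circ> g) \<longlonglongrightarrow> z"
    using seq_compactE[OF compact_imp_seq_compact[OF compact_cball], of c k "Inf A + 1"] by metis
  have "dist z x \<le> Inf A" if "x \<in> K" for x
  proof (rule LIMSEQ_le)
    show "(\<lambda>n. dist ((c \<circ> g) n) x) \<longlonglongrightarrow> dist z x" by (intro tendsto_intros g)
    have "(\<lambda>n. Inf A + inverse (real (Suc n))) \<longlonglongrightarrow> Inf A + 0"
      by (intro tendsto_intros LIMSEQ_inverse_real_of_nat)
    from LIMSEQ_subseq_LIMSEQ[OF this g(1)]
    show "(\<lambda>n. Inf A + inverse (real (Suc (g n)))) \<longlonglongrightarrow> Inf A" by (simp add: o_def)
    show "\<exists>N. \<forall>n\<ge>N. dist ((c \<circ> g) n) x \<le> Inf A + inverse (real (Suc (g n)))"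
      using c that by (auto simp: subset_iff)
  qed
  then have "K \<subseteq> cball z (Inf A)" by auto
  moreover have "0 \<le> Inf A" using A0 by (intro cInf_greatest ne)
  moreover have "Inf A \<le> r" if "K \<subseteq> cball c r" for c r
    using that bdd by (intro cInf_lower) (auto simp: A_def)
  ultimately show ?thesis using that R by metis
qed

text \<open>The supremum is finite because a contained ball has diameter at most that of
  \<open>K\<close>. Centres of nearly largest balls subconverge in \<open>K\<close>, and each point
  of the limit ball is a limit of points of these balls.\<close>

lemma inball_exists:
  fixes K :: "(real^2) set"
  assumes "compact K" "K \<noteq> {}"
  obtains c where "cball c (inradius K) \<subseteq> K" "0 \<le> inradius K"
proof -
  define A where "A = {r. r \<ge> 0 \<and> (\<exists>c. cball c r \<subseteq> K)}"
  have r: "inradius K = Sup A" by (simp add: inradius_def A_def)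
  obtain k where k: "k \<in> K" using assms(2) by blast
  have zA: "0 \<in> A" using k by (auto simp: A_def)
  have "2 * r \<le> diameter K" if "r \<in> A" for r
  proof -
    obtain c where c: "0 \<le> r" "cball c r \<subseteq> K" using \<open>r \<in> A\<close> by (auto simp: A_def)
    have "diameter (cball c r) \<le> diameter K"
      by (rule diameter_subset[OF c(2) compact_imp_bounded[OF assms(1)]])
    then show ?thesis using c(1) by (simp add: diameter_cball)
  qed
  then have bdd: "bdd_above A" by (intro bdd_aboveI[of _ "diameter K / 2"]) force
  have "\<exists>c t. cball c t \<subseteq> K \<and> Sup A - inverse (real (Suc n)) < t \<and> 0 \<le> t \<and> t \<le> Sup A" for n
  proof -
    obtain t where "t \<in> A" "Sup A - inverse (real (Suc n)) < t"
      using less_cSupD[of A "Sup A - inverse (real (Suc n))"] zA by auto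
    then show ?thesis using cSup_upper[OF _ bdd] by (auto simp: A_def)
  qed
  then obtain c t where ct: "\<And>n. cball (c n) (t n) \<subseteq> K" "\<And>n. Sup A - inverse (real (Suc n)) < t n"
      "\<And>n. 0 \<le> t n" "\<And>n. t n \<le> Sup A" by metis
  have "c n \<in> K" for n using ct(1,3)[of n] by (auto simp: subset_iff)
  then obtain z g where g: "strict_mono g" "(c \<circ> g) \<longlonglongrightarrow> z"
    using seq_compactE[OF compact_imp_seq_compact[OF assms(1)], of c] by metis
  have "t \<longlonglongrightarrow> Sup A"
  proof (rule tendsto_sandwich)
    have "(\<lambda>n. Sup A - inverse (real (Suc n))) \<longlonglongrightarrow> Sup A - 0"
      by (intro tendsto_intros LIMSEQ_inverse_real_of_nat)
    then show "(\<lambda>n. Sup A - inverse (real (Suc n))) \<longlonglongrightarrow> Sup A" by simp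
    show "(\<lambda>n. Sup A) \<longlonglongrightarrow> Sup A" by simp
  qed (use ct in \<open>auto intro!: always_eventually less_imp_le\<close>)
  then have t: "(t \<circ> g) \<longlonglongrightarrow> Sup A" by (rule LIMSEQ_subseq_LIMSEQ) (rule g)
  have S0: "0 \<le> Sup A" by (rule cSup_upper[OF zA bdd])
  have "cball z (Sup A) \<subseteq> K"
  proof
    fix y assume "y \<in> cball z (Sup A)"
    then have y: "norm (y - z) \<le> Sup A" by (simp add: dist_norm norm_minus_commute)
    \<comment> \<open>If \<open>Sup A = 0\<close>, division by zero gives \<open>v = 0\<close>,
      which is correct since then \<open>y = z\<close>.\<close>
    define v where "v = (y - z) /\<^sub>R Sup A"
    have "norm v = norm (y - z) / Sup A" using S0 by (simp add: v_def divide_inverse_commute)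
    then have v: "norm v \<le> 1" "y = z + Sup A *\<^sub>R v"
      using y S0 by (cases "Sup A = 0"; auto simp: v_def divide_le_eq_1)+
    have "(\<lambda>n. (c \<circ> g) n + (t \<circ> g) n *\<^sub>R v) \<longlonglongrightarrow> z + Sup A *\<^sub>R v"
      by (intro tendsto_intros g t)
    moreover have "(c \<circ> g) n + (t \<circ> g) n *\<^sub>R v \<in> K" for n
    proof -
      have "norm (t (g n) *\<^sub>R v) \<le> t (g n)" using v(1) ct(3)[of "g n"] by (simp add: mult_left_le)
      then show ?thesis using ct(1)[of "g n"] by (auto simp: subset_iff dist_norm)
    qed
    ultimately show "y \<in> K"
      unfolding v(2) using compact_imp_closed[OF assms(1)] by (meson closed_sequentially)
  qed
  then show ?thesis using that r S0 by metis
qed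

text \<open>Otherwise a hyperplane separates \<open>z\<close> from the contact points, and moving
  \<open>z\<close> slightly along its normal \<open>a\<close> brings every contact point closer.
  Minimality still leaves some point at distance at least \<open>R\<close> from each moved centre; a
  limit of these is a contact point on the wrong side.\<close>

lemma circumcentre_in_hull:
  fixes K :: "'a::euclidean_space set"
  assumes K: "compact K" and R: "K \<subseteq> cball z R"
    and least: "\<And>c r. K \<subseteq> cball c r \<Longrightarrow> R \<le> r"
  shows "z \<in> convex hull (K \<inter> sphere z R)"
proof (rule ccontr)
  let ?C = "convex hull (K \<inter> sphere z R)"
  assume nin: "z \<notin> ?C"
  have "compact ?C" using K by (intro compact_convex_hull compact_Int) auto
  then obtain a b where ab: "a \<bullet> z < b" "\<And>x. x \<in> ?C \<Longrightarrow> b < a \<bullet> x"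
    using separating_hyperplane_closed_point[of ?C z] nin by (auto simp: compact_imp_closed)
  have sep: "a \<bullet> (x - z) > 0" if "x \<in> K" "dist z x = R" for x
    using ab(1) ab(2)[of x] that hull_inc[of x "K \<inter> sphere z R"] by (auto simp: inner_diff_right)
  define \<epsilon> where "\<epsilon> n = inverse (real (Suc n))" for n
  have e0: "\<epsilon> n > 0" for n by (simp add: \<epsilon>_def)
  have "\<exists>x\<in>K. R \<le> dist (z + \<epsilon> n *\<^sub>R a) x" for n
  proof (rule ccontr)
    assume "\<not> ?thesis"
    then have lt: "\<And>x. x \<in> K \<Longrightarrow> dist (z + \<epsilon> n *\<^sub>R a) x < R" by force
    show False
    proof (cases "K = {}")
      case True
      then show False using least[of z "R - 1"] by simp
    next
      case False
      obtain y where y: "y \<in> K" "\<And>x. x \<in> K \<Longrightarrow> dist (z + \<epsilon> n *\<^sub>R a) x \<le> dist (z + \<epsilon> n *\<^sub>R a) y"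
        using distance_attains_sup[OF K False] by blast
      then have "K \<subseteq> cball (z + \<epsilon> n *\<^sub>R a) (dist (z + \<epsilon> n *\<^sub>R a) y)" by auto
      from least[OF this] show False using lt[OF y(1)] by simp
    qed
  qed
  then obtain x where x: "\<And>n. x n \<in> K" "\<And>n. R \<le> dist (z + \<epsilon> n *\<^sub>R a) (x n)" by metis
  obtain l g where l: "l \<in> K" "strict_mono g" "(x \<circ> g) \<longlonglongrightarrow> l"
    using seq_compactE[OF compact_imp_seq_compact[OF K], of x] x(1) by metis
  have R0: "0 \<le> R" using R l(1) zero_le_dist[of z l] by (metis mem_cball order_trans subsetD)
  have eps: "(\<epsilon> \<circ> g) \<longlonglongrightarrow> 0"
    using LIMSEQ_subseq_LIMSEQ[OF LIMSEQ_inverse_real_of_nat l(2)] by (simp add: \<epsilon>_def o_def)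
  have ineq: "2 * (a \<bullet> (x n - z)) \<le> \<epsilon> n * (norm a)\<^sup>2" for n
  proof -
    have 1: "(dist (z + \<epsilon> n *\<^sub>R a) (x n))\<^sup>2
        = (norm (x n - z))\<^sup>2 - 2 * \<epsilon> n * (a \<bullet> (x n - z)) + (\<epsilon> n)\<^sup>2 * (norm a)\<^sup>2"
      unfolding dist_norm power2_norm_eq_inner
      by (simp add: inner_diff_left inner_diff_right inner_add_left inner_add_right
          inner_commute power2_eq_square algebra_simps)
    have 2: "R\<^sup>2 \<le> (dist (z + \<epsilon> n *\<^sub>R a) (x n))\<^sup>2" using x(2) R0 by (intro power_mono)
    have "norm (x n - z) \<le> R" using R x(1)[of n] by (auto simp: subset_iff dist_norm norm_minus_commute)
    then have 3: "(norm (x n - z))\<^sup>2 \<le> R\<^sup>2" by (intro power_mono) auto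
    have "\<epsilon> n * (2 * (a \<bullet> (x n - z))) \<le> \<epsilon> n * (\<epsilon> n * (norm a)\<^sup>2)"
      using 1 2 3 by (simp add: power2_eq_square)
    then show ?thesis using e0[of n] by simp
  qed
  have "2 * (a \<bullet> (l - z)) \<le> 0 * (norm a)\<^sup>2"
  proof (rule LIMSEQ_le)
    show "(\<lambda>n. 2 * (a \<bullet> ((x \<circ> g) n - z))) \<longlonglongrightarrow> 2 * (a \<bullet> (l - z))" by (intro tendsto_intros l)
    show "(\<lambda>n. (\<epsilon> \<circ> g) n * (norm a)\<^sup>2) \<longlonglongrightarrow> 0 * (norm a)\<^sup>2" by (intro tendsto_intros eps)
  qed (use ineq in auto)
  moreover have "R \<le> dist z l"
  proof (rule LIMSEQ_le)
    show "(\<lambda>n. R) \<longlonglongrightarrow> R" by simp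
    have "(\<lambda>n. dist (z + (\<epsilon> \<circ> g) n *\<^sub>R a) ((x \<circ> g) n)) \<longlonglongrightarrow> dist (z + 0 *\<^sub>R a) l"
      by (intro tendsto_intros eps l)
    then show "(\<lambda>n. dist (z + (\<epsilon> \<circ> g) n *\<^sub>R a) ((x \<circ> g) n)) \<longlonglongrightarrow> dist z l" by simp
  qed (use x(2) in auto)
  ultimately show False using sep[of l] l(1) R by (auto simp: subset_iff)
qed

text \<open>Caratheodory's theorem in the plane; if fewer than three points suffice, one is
  repeated.\<close>

lemma plane_hull_triple:
  fixes z :: "real^2"
  assumes "z \<in> convex hull S"
  obtains p q s a b c where "p \<in> S" "q \<in> S" "s \<in> S" "0 \<le> a" "0 \<le> b" "0 \<le> c" "a + b + c = 1"
    "a *\<^sub>R (p - z) + b *\<^sub>R (q - z) + c *\<^sub>R (s - z) = 0"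
proof -
  obtain T where T: "finite T" "T \<subseteq> S" "card T \<le> 3" "z \<in> convex hull T"
    using assms unfolding caratheodory[of S] by auto
  have "T \<noteq> {}" using T(4) by auto
  then obtain p q s where "T = {p, q, s}"
  proof -
    have "card T \<noteq> 0" using T(1) \<open>T \<noteq> {}\<close> by simp
    then consider "card T = 1" | "card T = 2" | "card T = 3" using T(3) by linarith
    then show ?thesis
    proof cases
      case 1
      then obtain x where "T = {x}" by (rule card_1_singletonE)
      then show ?thesis using that[of x x x] by simp
    next
      case 2
      then obtain x y where "T = {x, y}" unfolding card_2_iff by blast
      then show ?thesis using that[of x x y] by simp
    next
      case 3
      then obtain x y w where "T = {x, y, w}" unfolding card_3_iff by blast
      then show ?thesis by (rule that)
    qed
  qed
  then obtain a b c where abc: "0 \<le> a" "0 \<le> b" "0 \<le> c" "a + b + c = 1"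
      "z = a *\<^sub>R p + b *\<^sub>R q + c *\<^sub>R s"
    using T(4) unfolding \<open>T = {p, q, s}\<close> convex_hull_3 by blast
  have "a *\<^sub>R (p - z) + b *\<^sub>R (q - z) + c *\<^sub>R (s - z) = z - (a + b + c) *\<^sub>R z"
    unfolding abc(5) by (simp add: algebra_simps)
  then have "a *\<^sub>R (p - z) + b *\<^sub>R (q - z) + c *\<^sub>R (s - z) = 0" using abc(4) by simp
  moreover have "p \<in> S" "q \<in> S" "s \<in> S" using T(2) \<open>T = {p, q, s}\<close> by auto
  ultimately show ?thesis using abc(1-4) by (intro that)
qed

text \<open>The point of the ball diametrically away from \<open>x\<close> is at distance
  \<open>dist x c + r\<close> from \<open>x\<close>.\<close>

lemma dist_centre_plus_radius_le_diameter:
  fixes K :: "'a::euclidean_space set"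
  assumes "bounded K" "cball c r \<subseteq> K" "0 \<le> r" "x \<in> K"
  shows "dist x c + r \<le> diameter K"
proof (cases "x = c")
  case True
  have "diameter (cball c r) \<le> diameter K" by (rule diameter_subset[OF assms(2,1)])
  then show ?thesis using True assms(3) by (simp add: diameter_cball)
next
  case False
  define y where "y = c - (r / norm (x - c)) *\<^sub>R (x - c)"
  have "norm (y - c) = r" using False assms(3) by (simp add: y_def)
  then have "y \<in> K" using assms(2) by (auto simp: subset_iff dist_norm norm_minus_commute)
  then have "dist x y \<le> diameter K" using assms(1,4) by (intro diameter_bounded_bound)
  moreover have "x - y = (1 + r / norm (x - c)) *\<^sub>R (x - c)" by (simp add: y_def algebra_simps)
  then have "dist x y = (1 + r / norm (x - c)) * norm (x - c)"
    using assms(3) by (simp add: dist_norm abs_of_nonneg)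
  then have "dist x y = dist x c + r"
    using False by (simp add: dist_norm distrib_right)
  ultimately show ?thesis by simp
qed

section \<open>Breadth of the body in a direction, and the width\<close>

lemma breadth_ge:
  fixes K :: "(real^2) set"
  assumes "compact K" "x \<in> K" "y \<in> K"
  shows "u \<bullet> x - u \<bullet> y \<le> (SUP x\<in>K. u \<bullet> x) - (INF x\<in>K. u \<bullet> x)"
proof -
  have "bounded ((\<bullet>) u ` K)"
    by (intro compact_imp_bounded compact_continuous_image assms continuous_intros)
  then have "bdd_above ((\<bullet>) u ` K)" "bdd_below ((\<bullet>) u ` K)"
    by (auto intro: bounded_imp_bdd_above bounded_imp_bdd_below)
  then show ?thesis using assms(2,3) by (intro diff_mono cSUP_upper cINF_lower)
qed

text \<open>The strict bounds on \<open>D\<close> make \<alpha> an angle strictly between 0 and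
  \<open>pi / 2\<close>. After translating the circumcentre to the origin, only the contact points
  and the inball are needed.\<close>

lemma breadth_bound_of_body:
  fixes K :: "(real^2) set" and u :: "real^2"
  defines "D \<equiv> diameter K" and "r \<equiv> inradius K" and "R \<equiv> circumradius K"
  assumes K: "compact K" "K \<noteq> {}" and u: "norm u = 1" and nondeg: "0 < D" "D < 2 * R"
  shows "2 * D * sqrt (1 - (D / (2 * R))\<^sup>2) *
           cos (arccos (D / (2 * (D - r))) + arccos (D / (2 * R)) - arcsin (r / (D - r)))
       \<le> (SUP x\<in>K. u \<bullet> x) - (INF x\<in>K. u \<bullet> x)" (is "?L \<le> ?f")
proof -
  define \<alpha> where "\<alpha> = arccos (D / (2 * R))"
  have R0: "0 < R" using nondeg by simp
  have DR: "0 < D / (2 * R)" "D / (2 * R) < 1" using nondeg R0 by (auto simp: field_simps)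
  have al: "0 < \<alpha>" "\<alpha> < pi / 2"
    using DR arccos_less_arccos[of "D / (2 * R)" 1] arccos_less_arccos[of 0 "D / (2 * R)"]
    by (auto simp: \<alpha>_def)
  have D: "D = 2 * R * cos \<alpha>" using DR R0 by (simp add: \<alpha>_def)
  have sa: "sqrt (1 - (D / (2 * R))\<^sup>2) = sin \<alpha>" using DR by (simp add: \<alpha>_def sin_arccos)
  obtain z where z: "K \<subseteq> cball z R" and least: "\<And>c r. K \<subseteq> cball c r \<Longrightarrow> R \<le> r"
    using circumball_exists[OF K] unfolding R_def by metis
  obtain c where c: "cball c r \<subseteq> K" and r0: "0 \<le> r" using inball_exists[OF K] unfolding r_def by metis
  have bK: "bounded K" by (rule compact_imp_bounded[OF K(1)])
  have cK: "dist x c \<le> D - r" if "x \<in> K" for x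
    using dist_centre_plus_radius_le_diameter[OF bK c r0 that] by (simp add: D_def)
  \<comment> \<open>The disk of radius \<open>D - r\<close> about the incentre contains
    \<open>K\<close>, so it competes with the circumball.\<close>
  have Rr: "R \<le> D - r" using cK by (intro least[of c]) (auto simp: dist_commute)
  \<comment> \<open>The extreme points of the inball in direction \<open>u\<close> yield the bounds
    on the breadth that involve \<open>r\<close>.\<close>
  have top: "c + r *\<^sub>R u \<in> K" "c - r *\<^sub>R u \<in> K" using c u r0 by (auto simp: subset_iff dist_norm)
  have uu: "u \<bullet> u = 1" using u by (simp add: norm_eq_1)
  have "dist (c + r *\<^sub>R u) (c - r *\<^sub>R u) \<le> D"
    unfolding D_def by (intro diameter_bounded_bound bK top)
  moreover have "dist (c + r *\<^sub>R u) (c - r *\<^sub>R u) = norm ((2 * r) *\<^sub>R u)"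
    unfolding dist_norm mult_2 scaleR_left_distrib by simp
  ultimately have rD: "2 * r \<le> D" using u r0 by simp
  have f: "u \<bullet> x - u \<bullet> y \<le> ?f" if "x \<in> K" "y \<in> K" for x y
    by (rule breadth_ge[OF K(1) that])
  have hull: "z \<in> convex hull (K \<inter> sphere z R)"
    by (rule circumcentre_in_hull[OF K(1) z]) (rule least)
  obtain p q s a b b' where pts: "p \<in> K \<inter> sphere z R" "q \<in> K \<inter> sphere z R" "s \<in> K \<inter> sphere z R"
    and coeff: "0 \<le> a" "0 \<le> b" "0 \<le> b'" "a + b + b' = 1"
      "a *\<^sub>R (p - z) + b *\<^sub>R (q - z) + b' *\<^sub>R (s - z) = 0"
    using plane_hull_triple[OF hull] by metis
  \<comment> \<open>Stated for arbitrary labels, so that each of the six orders of height is an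
    instance.\<close>
  have main: "2 * D * sin \<alpha> * cos (arccos (D / (2 * (D - r))) + \<alpha> - arcsin (r / (D - r))) \<le> ?f"
    if pts: "p \<in> K \<inter> sphere z R" "q \<in> K \<inter> sphere z R" "s \<in> K \<inter> sphere z R"
      and coeff: "0 \<le> a" "0 \<le> b" "0 \<le> b'" "a + b + b' = 1"
        "a *\<^sub>R (p - z) + b *\<^sub>R (q - z) + b' *\<^sub>R (s - z) = 0"
      and order: "u \<bullet> p \<le> u \<bullet> s" "u \<bullet> s \<le> u \<bullet> q" for p q s a b b'
  proof (rule breadth_bound[where R = R and r = r and D = D and p = "p - z" and q = "q - z"
        and s = "s - z" and c = "c - z" and u = u and a = a and b = b and b' = b'])
    show "norm (p - z) = R" "norm (q - z) = R" "norm (s - z) = R"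
      using pts by (auto simp: dist_norm norm_minus_commute)
    have "dist p q \<le> D" "dist q s \<le> D" "dist p s \<le> D"
      using pts bK unfolding D_def by (auto intro: diameter_bounded_bound)
    then show "dist (p - z) (q - z) \<le> D" "dist (q - z) (s - z) \<le> D" "dist (p - z) (s - z) \<le> D"
      by (auto simp: dist_norm)
    show "norm (c - z - (p - z)) \<le> D - r" "norm (c - z - (q - z)) \<le> D - r" "norm (c - z - (s - z)) \<le> D - r"
      using cK[of p] cK[of q] cK[of s] pts by (auto simp: dist_norm norm_minus_commute[of c])
    show "u \<bullet> (q - z) - u \<bullet> (p - z) \<le> ?f" using f[of q p] pts by (simp add: inner_diff_right)
    show "u \<bullet> (q - z) - u \<bullet> (c - z) + r \<le> ?f"
      using f[of q "c - r *\<^sub>R u"] pts top uu by (simp add: inner_diff_right)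
    show "u \<bullet> (c - z) - u \<bullet> (p - z) + r \<le> ?f"
      using f[of "c + r *\<^sub>R u" p] pts top uu by (simp add: inner_diff_right inner_add_right)
    show "2 * r \<le> ?f"
      using f[of "c + r *\<^sub>R u" "c - r *\<^sub>R u"] top uu by (simp add: inner_diff_right inner_add_right)
  qed (use R0 al r0 rD Rr D u order coeff in \<open>auto simp: inner_diff_right\<close>)
  have "2 * D * sin \<alpha> * cos (arccos (D / (2 * (D - r))) + \<alpha> - arcsin (r / (D - r))) \<le> ?f"
  proof -
    have swap: "a *\<^sub>R (p - z) + b' *\<^sub>R (s - z) + b *\<^sub>R (q - z) = 0"
      "b *\<^sub>R (q - z) + a *\<^sub>R (p - z) + b' *\<^sub>R (s - z) = 0"
      "b *\<^sub>R (q - z) + b' *\<^sub>R (s - z) + a *\<^sub>R (p - z) = 0"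
      "b' *\<^sub>R (s - z) + a *\<^sub>R (p - z) + b *\<^sub>R (q - z) = 0"
      "b' *\<^sub>R (s - z) + b *\<^sub>R (q - z) + a *\<^sub>R (p - z) = 0"
      "a + b' + b = 1" "b + a + b' = 1" "b + b' + a = 1" "b' + a + b = 1" "b' + b + a = 1"
      using coeff(4,5) by (simp_all add: ac_simps)
    consider "u \<bullet> p \<le> u \<bullet> s \<and> u \<bullet> s \<le> u \<bullet> q" | "u \<bullet> p \<le> u \<bullet> q \<and> u \<bullet> q \<le> u \<bullet> s"
      | "u \<bullet> q \<le> u \<bullet> s \<and> u \<bullet> s \<le> u \<bullet> p" | "u \<bullet> q \<le> u \<bullet> p \<and> u \<bullet> p \<le> u \<bullet> s"
      | "u \<bullet> s \<le> u \<bullet> q \<and> u \<bullet> q \<le> u \<bullet> p" | "u \<bullet> s \<le> u \<bullet> p \<and> u \<bullet> p \<le> u \<bullet> q"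
      by linarith
    then show ?thesis
    proof cases
      case 1 then show ?thesis using main[OF pts coeff] by blast
    next
      case 2 then show ?thesis using main[OF pts(1,3,2) coeff(1,3,2) swap(6,1)] by blast
    next
      case 3 then show ?thesis using main[OF pts(2,1,3) coeff(2,1,3) swap(7,2)] by blast
    next
      case 4 then show ?thesis using main[OF pts(2,3,1) coeff(2,3,1) swap(8,3)] by blast
    next
      case 5 then show ?thesis using main[OF pts(3,1,2) coeff(3,1,2) swap(9,4)] by blast
    next
      case 6 then show ?thesis using main[OF pts(3,2,1) coeff(3,2,1) swap(10,5)] by blast
    qed
  qed
  then show ?thesis unfolding sa \<alpha>_def[symmetric] .
qed

theorem theorem3p2:
  fixes K :: "(real^2) set"
  assumes "compact K" and "convex K" and "K \<noteq> {}"
  shows "width K \<ge> 2 * diameter K * sqrt (1 - (diameter K / (2 * circumradius K))^2) *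
           cos (arccos (diameter K / (2 * (diameter K - inradius K)))
                + arccos (diameter K / (2 * circumradius K))
                - arcsin (inradius K / (diameter K - inradius K)))"
    (is "?L \<le> width K")
proof -
  obtain z where z: "K \<subseteq> cball z (circumradius K)" "0 \<le> circumradius K"
    using circumball_exists[OF assms(1,3)] by metis
  have "diameter K \<le> diameter (cball z (circumradius K))"
    using z(1) by (intro diameter_subset bounded_cball)
  then have DR: "diameter K \<le> 2 * circumradius K" using z(2) by (simp add: diameter_cball)
  have D0: "0 \<le> diameter K" by (intro diameter_ge_0 compact_imp_bounded assms)
  obtain k where k: "k \<in> K" using assms(3) by blast
  have ne: "sphere (0 :: real^2) 1 \<noteq> {}" by simp
  have "?L \<le> (SUP x\<in>K. u \<bullet> x) - (INF x\<in>K. u \<bullet> x)" if "norm u = 1" for u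
  proof (cases "diameter K = 0 \<or> diameter K = 2 * circumradius K")
    case True
    \<comment> \<open>In both degenerate cases a factor of the bound vanishes: \<open>D\<close>
      itself or the square root. Otherwise \<open>0 < D < 2 * R\<close>.\<close>
    have "?L = 0" using True by (cases "diameter K = 0") auto
    show ?thesis unfolding \<open>?L = 0\<close> using breadth_ge[OF assms(1) k k, of u] by simp
  next
    case False
    then show ?thesis using breadth_bound_of_body[OF assms(1,3) that] DR D0 by simp
  qed
  then show ?thesis unfolding width_def by (intro cINF_greatest ne) simp
qed

end
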